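(* Let $X$ be a nonempty set and $\sigma\colon X\times X\to\mathbb{R}_+$ a function. Suppose that: (S) for all $x,y\in X$, $x\neq y$ if and only if $\sigma(x,y)>0$; and (B) $\sup\{\sigma(x,y): x,y\in\bar{B}(z,M)\}<\infty$ for all $z\in X$ and $M>0$. Let $C$ be a nonempty subset of $X$ and $T\colon C\to X$ a mapping such that the fixed point set $\mathrm{F}(T)$ is nonempty. Then the following are equivalent: (1) $T$ is strongly quasinonexpansive with respect to $\sigma$; (2) for any $z\in\mathrm{F}(T)$ and $M>0$ there exists a nondecreasing bounded function $\gamma\colon[0,\alpha]\to\mathbb{R}_+$ such that $\gamma(t)>0$ for all $t\in(0,\alpha]$ and \[\gamma\bigl(\sigma(Tx,x)\bigr)\le\sigma(z,x)-\sigma(z,Tx)\] for all $x\in D$, where $D=C\cap\bar{B}(z,M)$ and $\alpha=\sup\{\sigma(Tx,x):x\in D\}$.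
   Context: $\mathbb{R}_+$ is the set of nonnegative real numbers. No symmetry or triangle inequality is assumed for $\sigma$ beyond what is stated. For $z\in X$ and $M>0$, $\bar{B}(z,M)=\{x\in X:\sigma(z,x)\le M\}$. For $C\subset X$ and $T\colon C\to X$, $\mathrm{F}(T)=\{z\in C: z=Tz\}$. $T$ is strongly quasinonexpansive (with respect to $\sigma$) if $\mathrm{F}(T)\neq\emptyset$ and for any $z\in\mathrm{F}(T)$, $M>0$ and $\epsilon>0$ there exists $\delta>0$ such that $x\in C\cap\bar{B}(z,M)$ and $\sigma(z,x)-\sigma(z,Tx)<\delta$ imply $\sigma(Tx,x)<\epsilon$. In (2), the requirement that $\gamma$ be defined on $[0,\alpha]$ with real endpoints includes that $\alpha$ is finite. *)

theory Defs
  imports Complex_Main "HOL-Library.FuncSet"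
begin

text \<open>
  The underlying set is an explicit carrier \<open>X\<close>; the values of \<open>\<sigma>\<close> outside
  \<open>X \<times> X\<close> and of \<open>T\<close> outside \<open>C\<close> are never used.
\<close>

definition sball :: "'a set \<Rightarrow> ('a \<Rightarrow> 'a \<Rightarrow> real) \<Rightarrow> 'a \<Rightarrow> real \<Rightarrow> 'a set" where
  "sball X \<sigma> z M = {x \<in> X. \<sigma> z x \<le> M}"

definition Fix :: "'a set \<Rightarrow> ('a \<Rightarrow> 'a) \<Rightarrow> 'a set" where
  "Fix C T = {z \<in> C. z = T z}"

definition strongly_quasinonexpansive ::
  "'a set \<Rightarrow> ('a \<Rightarrow> 'a \<Rightarrow> real) \<Rightarrow> 'a set \<Rightarrow> ('a \<Rightarrow> 'a) \<Rightarrow> bool" where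
  "strongly_quasinonexpansive X \<sigma> C T \<longleftrightarrow>
     Fix C T \<noteq> {} \<and>
     (\<forall>z \<in> Fix C T. \<forall>M>0. \<forall>\<epsilon>>0. \<exists>\<delta>>0. \<forall>x \<in> C \<inter> sball X \<sigma> z M.
        \<sigma> z x - \<sigma> z (T x) < \<delta> \<longrightarrow> \<sigma> (T x) x < \<epsilon>)"

end

theory Submission
  imports Defs
begin

text \<open>
  The modulus is \<open>\<gamma> t = inf {\<sigma> z x - \<sigma> z (T x) | x \<in> D, \<sigma> (T x) x \<ge> t}\<close>. At
  \<open>t = \<alpha>\<close> the supremum need not be attained and this set may be empty, so \<open>M\<close> is added to
  it; this also bounds \<open>\<gamma>\<close>. Strong quasinonexpansiveness forces
  \<open>\<sigma> z (T x) \<le> \<sigma> z x\<close>, since a negative difference lies below every \<open>\<delta>\<close> and would give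
  \<open>T x = x\<close>; so \<open>T\<close> maps \<open>D\<close> into the same ball, and (B) makes \<open>\<alpha>\<close> finite. Conversely,
  \<open>\<delta> = \<gamma> \<epsilon>\<close> works whenever \<open>\<epsilon> \<le> \<alpha>\<close>.
\<close>

text \<open>In the application \<open>f x\<close> is the displacement
  \<open>\<sigma> (T x) x\<close> and \<open>g x\<close> the decrease
  \<open>\<sigma> z x - \<sigma> z (T x)\<close>. Here \<open>\<gamma>\<close> lives on all of the
  reals, so the supremum of \<open>f\<close> never enters the construction.\<close>

lemma modulus_exists:
  fixes f g :: "'a \<Rightarrow> real"
  assumes "M > 0" and g0: "\<And>x. x \<in> D \<Longrightarrow> g x \<ge> 0"
    and small: "\<And>\<epsilon>. \<epsilon> > 0 \<Longrightarrow> \<exists>\<delta>>0. \<forall>x\<in>D. g x < \<delta> \<longrightarrow> f x < \<epsilon>"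
  obtains \<gamma> :: "real \<Rightarrow> real" where "mono \<gamma>" "\<And>t. 0 \<le> \<gamma> t" "\<And>t. \<gamma> t \<le> M"
    "\<And>t. t > 0 \<Longrightarrow> \<gamma> t > 0" "\<And>x. x \<in> D \<Longrightarrow> \<gamma> (f x) \<le> g x"
proof
  define V where "V t = insert M (g ` {x \<in> D. t \<le> f x})" for t
  have lb: "0 \<le> v" if "v \<in> V t" for t v
    using that \<open>M > 0\<close> g0 by (auto simp: V_def)
  have bdd: "bdd_below (V t)" for t
    using lb by (meson bdd_belowI)
  have ne: "V t \<noteq> {}" for t by (simp add: V_def)
  show "mono (\<lambda>t. Inf (V t))"
  proof (rule monoI)
    fix s t :: real assume "s \<le> t"
    then have "V t \<subseteq> V s" by (auto simp: V_def)
    then show "Inf (V s) \<le> Inf (V t)" by (rule cInf_superset_mono[OF ne bdd])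
  qed
  show "0 \<le> Inf (V t)" for t
    using ne lb by (rule cInf_greatest)
  show "Inf (V t) \<le> M" for t
    by (rule cInf_lower[OF _ bdd]) (simp add: V_def)
  show "Inf (V (f x)) \<le> g x" if "x \<in> D" for x
    by (rule cInf_lower[OF _ bdd]) (use that in \<open>auto simp: V_def\<close>)
  show "Inf (V t) > 0" if t: "t > 0" for t
  proof -
    from small[OF t] obtain \<delta> where \<delta>: "\<delta> > 0" "\<And>x. x \<in> D \<Longrightarrow> g x < \<delta> \<Longrightarrow> f x < t"
      by blast
    \<comment> \<open>By contraposition of \<open>small\<close>, \<open>t \<le> f x\<close> forces
      \<open>\<delta> \<le> g x\<close>; the minimum accounts for the inserted element
      \<open>M\<close>.\<close>
    have "min M \<delta> \<le> v" if "v \<in> V t" for v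
      using that \<delta>(2) by (force simp: V_def)
    then have "min M \<delta> \<le> Inf (V t)" using ne by (meson cInf_greatest)
    then show ?thesis using \<open>M > 0\<close> \<delta>(1) by linarith
  qed
qed

text \<open>If \<open>\<epsilon> \<le> f x\<close>, monotonicity gives
  \<open>\<gamma> \<epsilon> \<le> \<gamma> (f x) \<le> g x\<close>, so a smaller \<open>g x\<close>
  excludes this.\<close>

lemma small_if_modulus:
  fixes f g :: "'a \<Rightarrow> real"
  assumes "\<epsilon> > 0" and f: "\<And>x. x \<in> D \<Longrightarrow> f x \<in> {0..a}"
    and mono: "mono_on {0..a} \<gamma>" and pos: "\<And>t. t \<in> {0<..a} \<Longrightarrow> \<gamma> t > (0 :: real)"
    and le: "\<And>x. x \<in> D \<Longrightarrow> \<gamma> (f x) \<le> g x"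
  shows "\<exists>\<delta>>0. \<forall>x\<in>D. g x < \<delta> \<longrightarrow> f x < \<epsilon>"
proof (cases "\<epsilon> \<le> a")
  case True
  show ?thesis
  proof (intro exI[of _ "\<gamma> \<epsilon>"] conjI ballI impI)
    show "\<gamma> \<epsilon> > 0" using pos \<open>\<epsilon> > 0\<close> True by simp
    fix x assume x: "x \<in> D" "g x < \<gamma> \<epsilon>"
    show "f x < \<epsilon>"
    proof (rule ccontr)
      assume "\<not> f x < \<epsilon>"
      then have "\<gamma> \<epsilon> \<le> \<gamma> (f x)"
        using f[OF x(1)] \<open>\<epsilon> > 0\<close> True by (intro mono_onD[OF mono]) auto
      then show False using le[OF x(1)] x(2) by linarith
    qed
  qed
next
  case False
  \<comment> \<open>Every \<open>f x\<close> is at most \<open>a < \<epsilon>\<close>, so the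
    conclusion holds for any positive \<delta>.\<close>
  then show ?thesis using f by (intro exI[of _ 1]) force
qed

lemma strongly_quasinonexpansive_le:
  assumes sqne: "strongly_quasinonexpansive X \<sigma> C T" and z: "z \<in> Fix C T" and x: "x \<in> C"
    and CX: "C \<subseteq> X" and TX: "T \<in> C \<rightarrow> X"
    and S: "\<And>x y. x \<in> X \<Longrightarrow> y \<in> X \<Longrightarrow> x \<noteq> y \<longleftrightarrow> \<sigma> x y > 0"
  shows "\<sigma> z (T x) \<le> \<sigma> z x"
proof (rule ccontr)
  assume *: "\<not> \<sigma> z (T x) \<le> \<sigma> z x"
  \<comment> \<open>The radius must be positive and the ball must contain \<open>x\<close>, while
    \<open>\<sigma> z x\<close> itself may be 0.\<close>
  define M where "M = max 1 (\<sigma> z x)"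
  have "M > 0" and xM: "x \<in> C \<inter> sball X \<sigma> z M" using x CX by (auto simp: M_def sball_def)
  have "\<sigma> (T x) x < \<epsilon>" if \<epsilon>: "\<epsilon> > 0" for \<epsilon>
  proof -
    obtain \<delta> where "\<delta> > 0" "\<forall>x \<in> C \<inter> sball X \<sigma> z M. \<sigma> z x - \<sigma> z (T x) < \<delta> \<longrightarrow> \<sigma> (T x) x < \<epsilon>"
      using sqne z \<open>M > 0\<close> \<epsilon> unfolding strongly_quasinonexpansive_def by blast
    then show ?thesis using xM * by force
  qed
  \<comment> \<open>A positive displacement would be less than itself: take it as
    \<epsilon>.\<close>
  then have "\<not> \<sigma> (T x) x > 0" by blast
  moreover have "T x \<in> X" using x TX by blast
  ultimately have "T x = x" using S[of "T x" x] x CX by blast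
  then show False using * by simp
qed

theorem theorem4p6:
  fixes X C :: "'a set" and \<sigma> :: "'a \<Rightarrow> 'a \<Rightarrow> real" and T :: "'a \<Rightarrow> 'a"
  assumes "X \<noteq> {}"
    and "\<And>x y. x \<in> X \<Longrightarrow> y \<in> X \<Longrightarrow> \<sigma> x y \<ge> 0"
    and S: "\<And>x y. x \<in> X \<Longrightarrow> y \<in> X \<Longrightarrow> x \<noteq> y \<longleftrightarrow> \<sigma> x y > 0"
    and B: "\<And>z M. z \<in> X \<Longrightarrow> M > 0 \<Longrightarrow>
              bdd_above {\<sigma> x y |x y. x \<in> sball X \<sigma> z M \<and> y \<in> sball X \<sigma> z M}"
    and "C \<noteq> {}" and "C \<subseteq> X" and "T \<in> C \<rightarrow> X"
    and "Fix C T \<noteq> {}"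
  shows "strongly_quasinonexpansive X \<sigma> C T \<longleftrightarrow>
    (\<forall>z \<in> Fix C T. \<forall>M>0.
       let D = C \<inter> sball X \<sigma> z M;
           A = (\<lambda>x. \<sigma> (T x) x) ` D;
           \<alpha> = Sup A
       in bdd_above A \<and>
          (\<exists>\<gamma> :: real \<Rightarrow> real.
             \<gamma> \<in> {0..\<alpha>} \<rightarrow> {0..} \<and>
             mono_on {0..\<alpha>} \<gamma> \<and>
             bdd_above (\<gamma> ` {0..\<alpha>}) \<and>
             (\<forall>t \<in> {0<..\<alpha>}. \<gamma> t > 0) \<and>
             (\<forall>x \<in> D. \<gamma> (\<sigma> (T x) x) \<le> \<sigma> z x - \<sigma> z (T x))))"
proof -
  note nonneg = assms(2) and CX = assms(6) and TX = assms(7)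
  have TxX: "T x \<in> X" if "x \<in> C" for x using TX that by blast
  have f0: "0 \<le> \<sigma> (T x) x" if "x \<in> C" for x
    using nonneg TxX CX that by blast
  show ?thesis (is "?L \<longleftrightarrow> ?R")
  proof
    assume L: ?L
    show ?R
      unfolding Let_def
    proof (intro ballI allI impI conjI)
      fix z and M :: real assume z: "z \<in> Fix C T" and M: "M > 0"
      let ?D = "C \<inter> sball X \<sigma> z M"
      let ?g = "\<lambda>x. \<sigma> z x - \<sigma> z (T x)"
      have zX: "z \<in> X" using z CX by (auto simp: Fix_def)
      have g0: "\<sigma> z (T x) \<le> \<sigma> z x" if "x \<in> ?D" for x
        using strongly_quasinonexpansive_le[OF L z _ CX TX S] that by blast
      have "T x \<in> sball X \<sigma> z M" if "x \<in> ?D" for x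
        using g0[OF that] TxX[of x] that by (auto simp: sball_def)
      \<comment> \<open>Each displacement is the value of \<sigma> at the pair \<open>T x\<close>,
        \<open>x\<close>, both in the ball.\<close>
      then have "(\<lambda>x. \<sigma> (T x) x) ` ?D
          \<subseteq> {\<sigma> x y |x y. x \<in> sball X \<sigma> z M \<and> y \<in> sball X \<sigma> z M}"
        by blast
      then show "bdd_above ((\<lambda>x. \<sigma> (T x) x) ` ?D)"
        by (rule bdd_above_mono[OF B[OF zX M]])
      have g0': "0 \<le> ?g x" if "x \<in> ?D" for x
        using g0[OF that] by simp
      have small: "\<exists>\<delta>>0. \<forall>x\<in>?D. ?g x < \<delta> \<longrightarrow> \<sigma> (T x) x < \<epsilon>" if "\<epsilon> > 0" for \<epsilon>
        using L z M that unfolding strongly_quasinonexpansive_def by blast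
      obtain \<gamma> where \<gamma>: "mono \<gamma>" "\<And>t. 0 \<le> \<gamma> t" "\<And>t. \<gamma> t \<le> M"
        "\<And>t. t > 0 \<Longrightarrow> \<gamma> t > 0" "\<And>x. x \<in> ?D \<Longrightarrow> \<gamma> (\<sigma> (T x) x) \<le> ?g x"
        by (rule modulus_exists[OF M g0' small]) (assumption | rule that)+
      \<comment> \<open>If \<open>?D\<close> is empty, this supremum is an unspecified real; the
        properties of \<open>\<gamma>\<close> hold on the whole line and so restrict to
        \<open>{0..\<alpha>}\<close> in every case.\<close>
      define \<alpha> where "\<alpha> = Sup ((\<lambda>x. \<sigma> (T x) x) ` ?D)"
      have "\<gamma> \<in> {0..\<alpha>} \<rightarrow> {0..}" "mono_on {0..\<alpha>} \<gamma>"
        "\<forall>t \<in> {0<..\<alpha>}. \<gamma> t > 0" "\<forall>x \<in> ?D. \<gamma> (\<sigma> (T x) x) \<le> ?g x"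
        using \<gamma> by (auto intro: mono_on_subset)
      moreover have "bdd_above (\<gamma> ` {0..\<alpha>})"
        using \<gamma>(3) by (rule bdd_aboveI2)
      ultimately show "\<exists>\<gamma> :: real \<Rightarrow> real.
          \<gamma> \<in> {0..Sup ((\<lambda>x. \<sigma> (T x) x) ` ?D)} \<rightarrow> {0..} \<and>
          mono_on {0..Sup ((\<lambda>x. \<sigma> (T x) x) ` ?D)} \<gamma> \<and>
          bdd_above (\<gamma> ` {0..Sup ((\<lambda>x. \<sigma> (T x) x) ` ?D)}) \<and>
          (\<forall>t \<in> {0<..Sup ((\<lambda>x. \<sigma> (T x) x) ` ?D)}. \<gamma> t > 0) \<and>
          (\<forall>x \<in> ?D. \<gamma> (\<sigma> (T x) x) \<le> ?g x)"
        unfolding \<alpha>_def by (intro exI[of _ \<gamma>] conjI)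
    qed
  next
    assume R: ?R
    show ?L
      unfolding strongly_quasinonexpansive_def
    proof (intro conjI ballI allI impI)
      show "Fix C T \<noteq> {}" by fact
      fix z and M \<epsilon> :: real assume z: "z \<in> Fix C T" and M: "M > 0" and \<epsilon>: "\<epsilon> > 0"
      let ?D = "C \<inter> sball X \<sigma> z M"
      let ?A = "(\<lambda>x. \<sigma> (T x) x) ` ?D"
      obtain \<gamma> where bdd: "bdd_above ?A" and mono: "mono_on {0..Sup ?A} \<gamma>"
        and pos: "\<forall>t \<in> {0<..Sup ?A}. \<gamma> t > (0 :: real)"
        and le: "\<forall>x \<in> ?D. \<gamma> (\<sigma> (T x) x) \<le> \<sigma> z x - \<sigma> z (T x)"
        using R[unfolded Let_def, rule_format, OF z M] by (elim conjE exE) (rule that)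
      \<comment> \<open>Boundedness of \<open>?A\<close> makes \<open>Sup ?A\<close> a true upper
        bound, so \<open>\<gamma>\<close> is only evaluated where it is known to be
        monotone.\<close>
      have "\<sigma> (T x) x \<in> {0..Sup ?A}" if "x \<in> ?D" for x
        using f0[of x] cSup_upper[OF imageI[OF that] bdd] that by simp
      then show "\<exists>\<delta>>0. \<forall>x\<in>?D. \<sigma> z x - \<sigma> z (T x) < \<delta> \<longrightarrow> \<sigma> (T x) x < \<epsilon>"
        by (rule small_if_modulus[OF \<epsilon> _ mono]) (use pos le in blast)+
    qed
  qed
qed

end
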